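(* Suppose $\Omega_1\subset\mathbb{C}$ is bounded and $\Omega_2\subset\mathbb{C}$ has non-empty interior. Let $A:\mathbb{C}[z]\rightarrow\mathbb{C}[z]$ be a linear map. Then $A(\mathcal{S}(\Omega_1))\subset\mathcal{S}(\Omega_2)$ if and only if at least one of the following holds: (1) there exist a linear functional $\nu:\mathbb{C}[z]\rightarrow\mathbb{C}$ and a polynomial $\psi\in\mathcal{S}(\Omega_2)$ such that $A(f)=\nu(f)\psi$ for all $f\in\mathbb{C}[z]$; or (2) there exist $\psi\in\mathcal{S}(\Omega_2)$ and a non-constant polynomial $\varphi$ with $\varphi(\Omega_2)\subset\Omega_1$ such that $A=M_\psi C_\varphi$.
   Context: $\mathbb{C}[z]$ is the complex vector space of univariate complex polynomials. For a set $\Omega\subset\mathbb{C}$, $\mathcal{S}(\Omega)\subset\mathbb{C}[z]$ is the set of all polynomials having no zeros in $\Omega$, together with the zero polynomial. For polynomials $\psi,\varphi$, the operator $M_\psi C_\varphi:\mathbb{C}[z]\to\mathbb{C}[z]$ is defined by $M_\psi C_\varphi p=\psi\cdot(p\circ\varphi)$. *)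

theory Defs
  imports "HOL-Analysis.Analysis" "HOL-Computational_Algebra.Computational_Algebra"
begin

definition zero_free_polys :: "complex set \<Rightarrow> complex poly set" where
  "zero_free_polys \<Omega> = {p. \<forall>z\<in>\<Omega>. poly p z \<noteq> 0} \<union> {0}"

definition weighted_comp :: "complex poly \<Rightarrow> complex poly \<Rightarrow> complex poly \<Rightarrow> complex poly" where
  "weighted_comp \<psi> \<phi> p = \<psi> * pcompose p \<phi>"

(* The scalar action on complex polynomials is smult; the instance below shows that the
   vector-space assumption built into "Vector_Spaces.linear smult" is satisfied. *)
lemma vector_space_smult: "vector_space (smult :: complex \<Rightarrow> complex poly \<Rightarrow> complex poly)"
  by unfold_locales (simp_all add: smult_add_right smult_add_left)

end

(*
Let R be such that the closed disc K of radius R contains Omega1. If A kills some f without zeros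
on K, then a large multiple of f added to any g has no zeros on K, so A g lies in S(Omega2) for
every g, and such a linear range has dimension at most one.

Otherwise each functional L f = (A f)(w), w in Omega2, is nonzero on every f without zeros on K,
and a version of the Gleason-Kahane-Zelazko argument shows that L is a multiple of an evaluation:
P_n(x) = L((1 + x z)^n) has no zeros in |x| < 1/R, so P_n' = H_n P_n where the j-th Taylor
coefficient of H_n is at most n R^(j+1). Comparing the coefficients of x^m, dividing by n^(m+1)
and letting n tend to infinity gives L(1) L(z^(m+1)) = L(z) L(z^m).

Hence A f = A 1 * (f o phi) on Omega2 with phi = A z / A 1, and phi is a polynomial because
(A 1)^k divides (A z)^(k+1) for all k.
*)
theory Submission imports Defs "HOL-Computational_Algebra.Field_as_Ring"
begin

section \<open>Functionals that do not vanish on polynomials zero-free in a disc\<close>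

lemma LIMSEQ_binomial_over_power:
  "(\<lambda>n. of_nat (n choose k) / of_nat n ^ k) \<longlonglongrightarrow> (1 / fact k :: complex)"
proof (induction k)
  case (Suc k)
  have lim: "(\<lambda>n. of_nat (n - k) / of_nat n) \<longlonglongrightarrow> (1 :: complex)"
  proof (rule Lim_transform_eventually)
    have "(\<lambda>n. 1 - of_nat k * (1 / of_nat n)) \<longlonglongrightarrow> (1 - of_nat k * 0 :: complex)"
      by (intro tendsto_intros lim_1_over_n)
    then show "(\<lambda>n. 1 - of_nat k * (1 / of_nat n)) \<longlonglongrightarrow> (1 :: complex)"
      by simp
    \<comment> \<open>Subtraction in \<open>n - k\<close> is truncated, so the equality is claimed
      only for large n.\<close>
    show "\<forall>\<^sub>F n in sequentially. 1 - of_nat k * (1 / of_nat n) = (of_nat (n - k) / of_nat n :: complex)"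
      using eventually_gt_at_top[of "k"]
      by eventually_elim (auto simp: field_simps of_nat_diff)
  qed
  have "(\<lambda>n. of_nat (n choose k) / of_nat n ^ k * (of_nat (n - k) / of_nat n) / of_nat (Suc k))
      \<longlonglongrightarrow> (1 / fact k * 1 / of_nat (Suc k) :: complex)"
    by (rule tendsto_divide[OF tendsto_mult[OF Suc.IH lim] tendsto_const]) (simp del: of_nat_Suc)
  moreover have "of_nat (n choose Suc k) / of_nat n ^ Suc k
      = (of_nat (n choose k) / of_nat n ^ k * (of_nat (n - k) / of_nat n) / of_nat (Suc k) :: complex)" for n
  proof -
    have "of_nat (Suc k * (n choose Suc k)) = (of_nat ((n - k) * (n choose k)) :: complex)"
      by (simp only: binomial_absorption binomial_absorb_comp)
    then have "of_nat (n choose Suc k) = (of_nat (n - k) * of_nat (n choose k) / of_nat (Suc k) :: complex)"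
      by (simp only: of_nat_mult) (simp add: field_simps del: of_nat_Suc)
    then show ?thesis by (simp add: mult_ac)
  qed
  ultimately show ?case
    by (simp add: field_simps)
qed simp

text \<open>Each root r contributes 1/(x - r) to the logarithmic derivative P'/P. Its coefficient at
  x^j is -1/r^(j+1), of norm at most R^(j+1) because r lies outside the open disc of radius 1/R.
  Splitting off one root at a time adds up these bounds. Formal power series keep the argument free
  of convergence questions.\<close>

lemma ex_fps_log_deriv_bound:
  fixes P :: "complex poly" and R :: real
  assumes "R > 0" and "\<And>x. norm x < 1 / R \<Longrightarrow> poly P x \<noteq> 0"
  shows "\<exists>H. fps_deriv (fps_of_poly P) = H * fps_of_poly P \<and> (\<forall>j. norm (H $ j) \<le> degree P * R ^ Suc j)"
  using assms(2)
proof (induction "degree P" arbitrary: P)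
  case 0
  then obtain c where "P = [:c:]"
    by (metis degree_eq_zeroE)
  then show ?case
    by (intro exI[of _ 0]) (simp add: fps_of_poly_const)
next
  case (Suc n)
  then obtain r where r: "poly P r = 0"
    using alg_closed_imp_poly_has_root[of P] by (metis zero_less_Suc)
  then obtain Q where Q: "P = [:-r, 1:] * Q"
    by (auto simp: poly_eq_0_iff_dvd)
  have "Q \<noteq> 0"
    using Suc.hyps(2) Q by auto
  have "degree P = Suc (degree Q)"
    unfolding Q using \<open>Q \<noteq> 0\<close> by (subst degree_mult_eq) auto
  moreover have "poly Q x \<noteq> 0" if "norm x < 1 / R" for x
    using Suc.prems[OF that] Q by auto
  ultimately obtain H where H: "fps_deriv (fps_of_poly Q) = H * fps_of_poly Q"
    "\<And>j. norm (H $ j) \<le> degree Q * R ^ Suc j"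
    using Suc.hyps by (metis Suc_inject)
  have rR: "norm r \<ge> 1 / R"
    using r Suc.prems[of r] by force
  then have [simp]: "r \<noteq> 0"
    using \<open>R > 0\<close> by auto
  \<comment> \<open>The geometric expansion of 1/(x - r) at 0.\<close>
  define G where "G = Abs_fps (\<lambda>j. - inverse (r ^ Suc j))"
  have G: "G * fps_of_poly [:-r, 1:] = 1"
  proof (rule fps_ext)
    fix j
    show "(G * fps_of_poly [:-r, 1:]) $ j = 1 $ j"
      by (cases j) (simp_all add: fps_of_poly_linear distrib_left G_def field_simps)
  qed
  have "fps_deriv (fps_of_poly P) = fps_of_poly Q + fps_of_poly [:-r, 1:] * fps_deriv (fps_of_poly Q)"
    unfolding Q fps_of_poly_mult fps_of_poly_linear by simp
  also have "\<dots> = (G * fps_of_poly [:-r, 1:]) * fps_of_poly Q + fps_of_poly [:-r, 1:] * (H * fps_of_poly Q)"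
    by (simp only: G H mult_1_left)
  also have "\<dots> = (G + H) * fps_of_poly P"
    by (simp only: Q fps_of_poly_mult algebra_simps)
  finally have "fps_deriv (fps_of_poly P) = (G + H) * fps_of_poly P" .
  moreover have "norm ((G + H) $ j) \<le> degree P * R ^ Suc j" for j
  proof -
    have "inverse (norm r) \<le> R"
      using rR \<open>R > 0\<close> by (simp add: field_simps)
    then have "inverse (norm r) ^ Suc j \<le> R ^ Suc j"
      by (intro power_mono) auto
    then have "norm (G $ j) \<le> R ^ Suc j"
      by (simp add: G_def norm_inverse norm_power norm_mult power_inverse)
    then have "norm ((G + H) $ j) \<le> R ^ Suc j + degree Q * R ^ Suc j"
      unfolding fps_add_nth using H(2)[of j] norm_triangle_ineq[of "G $ j" "H $ j"] by linarith
    then show ?thesis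
      using \<open>degree P = Suc (degree Q)\<close> by (simp add: algebra_simps)
  qed
  ultimately show ?case
    by blast
qed

text \<open>The moments \<open>c k\<close> of \<open>L\<close> turn out to form a geometric sequence
  with ratio \<open>c 1 / c 0\<close>, and these are the moments of \<open>c 0\<close> times
  evaluation at that ratio.\<close>

lemma linear_functional_eq_scaled_eval:
  fixes L :: "complex poly \<Rightarrow> complex"
  assumes L: "Vector_Spaces.linear smult (*) L" and "R > 0"
    and nz: "\<And>f. (\<And>z. norm z \<le> R \<Longrightarrow> poly f z \<noteq> 0) \<Longrightarrow> L f \<noteq> 0"
  shows "L f = L 1 * poly f (L [:0, 1:] / L 1)"
proof -
  interpret Vector_Spaces.linear smult "(*)" L by fact
  define c where "c k = L (monom 1 k)" for k
  have L_eq: "L f = (\<Sum>i\<le>n. coeff f i * c i)" if "degree f \<le> n" for f n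
  proof -
    have "L f = L (\<Sum>i\<le>n. smult (coeff f i) (monom 1 i))"
      using poly_as_sum_of_monoms'[OF that] by (simp add: smult_monom)
    then show ?thesis
      by (simp only: sum scale c_def)
  qed
  have c0: "c 0 \<noteq> 0"
    using nz[of 1] by (simp add: c_def)
  \<comment> \<open>By the binomial theorem this is \<open>L\<close> applied to (1 + x z)^n, as a
    polynomial in x. For norm x < 1/R the factor 1 + x z has no zero with norm z at most R, so
    \<open>nz\<close> applies.\<close>
  define P where "P n = (\<Sum>k\<le>n. monom (of_nat (n choose k) * c k) k)" for n
  have coeff_P: "coeff (P n) k = of_nat (n choose k) * c k" for n k
    by (auto simp: P_def coeff_sum coeff_monom if_distrib sum.delta cong: if_cong)
  have deg_P: "degree (P n) \<le> n" for n
    by (rule degree_le) (simp add: coeff_P)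
  have "poly (P n) x = L ([:1, x:] ^ n)" for n x
    using L_eq[of "[:1, x:] ^ n" n]
    by (simp add: P_def poly_sum poly_monom coeff_linear_poly_power degree_power_le[THEN order_trans] mult_ac)
  moreover have "L ([:1, x:] ^ n) \<noteq> 0" if "norm x < 1 / R" for n x
  proof (rule nz)
    fix z :: complex assume "norm z \<le> R"
    then have "norm (z * x) \<le> R * norm x"
      by (simp add: norm_mult mult_right_mono)
    also have "\<dots> < 1"
      using that \<open>R > 0\<close> by (simp add: field_simps)
    finally have "z * x \<noteq> - 1"
      by auto
    then show "poly ([:1, x:] ^ n) z \<noteq> 0"
      by (auto simp: add_eq_0_iff)
  qed
  ultimately have "poly (P n) x \<noteq> 0" if "norm x < 1 / R" for n x
    using that by presburger
  then have "\<exists>H. fps_deriv (fps_of_poly (P n)) = H * fps_of_poly (P n) \<and>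
      (\<forall>j. norm (H $ j) \<le> degree (P n) * R ^ Suc j)" for n
    using \<open>R > 0\<close> by (intro ex_fps_log_deriv_bound)
  then obtain H where H: "\<And>n. fps_deriv (fps_of_poly (P n)) = H n * fps_of_poly (P n)"
    and H_le: "\<And>n j. norm (H n $ j) \<le> degree (P n) * R ^ Suc j"
    by metis
  have H_le': "norm (H n $ j) \<le> n * R ^ Suc j" for n j
    using H_le[of n j] deg_P[of n] \<open>R > 0\<close>
    by (meson mult_right_mono of_nat_mono order_trans zero_le_power less_imp_le)
  have rec: "of_nat (Suc m) * (of_nat (n choose Suc m) * c (Suc m)) =
      (\<Sum>j\<le>m. H n $ j * (of_nat (n choose (m - j)) * c (m - j)))" for n m
    using arg_cong[OF H, of "\<lambda>f. f $ m" n]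
    by (simp add: fps_mult_nth coeff_P atMost_atLeast0)
  have H0: "H n $ 0 = of_nat n * (c 1 / c 0)" for n
    using rec[of 0 n] c0 by (simp add: field_simps)
  have c_Suc: "c (Suc m) = c 1 / c 0 * c m" for m
  proof -
    let ?q = "\<lambda>k n. of_nat (n choose k) / of_nat n ^ k :: complex"
    \<comment> \<open>The divisor n^(m+1) is split as n^(j+1) * n^(m-j), one factor for
      \<open>H n $ j\<close> and one for the binomial coefficient. Only j = 0 survives:
      \<open>H n $ 0\<close> is exactly n * c 1 / c 0, while for j > 0 the numerator grows at most
      linearly in n against a divisor of order n^(j+1).\<close>
    have "(\<lambda>n. H n $ j / of_nat n ^ Suc j * (?q (m - j) n * c (m - j))) \<longlonglongrightarrow>
        (if j = 0 then c 1 / c 0 else 0) * (1 / fact (m - j) * c (m - j))" for j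
    proof (intro tendsto_mult LIMSEQ_binomial_over_power tendsto_const)
      show "(\<lambda>n. H n $ j / of_nat n ^ Suc j) \<longlonglongrightarrow> (if j = 0 then c 1 / c 0 else 0)"
      proof (cases j)
        case 0
        \<comment> \<open>At n = 0 the right-hand side is 0 by the convention for division by
          zero.\<close>
        have "\<forall>\<^sub>F n in sequentially. c 1 / c 0 = H n $ j / of_nat n ^ Suc j"
          using eventually_gt_at_top[of 0] by eventually_elim (simp add: 0 H0)
        then show ?thesis
          using 0 by (auto intro: Lim_transform_eventually[OF tendsto_const])
      next
        case (Suc i)
        have "(\<lambda>n. R ^ Suc j * (1 / real n) ^ j) \<longlonglongrightarrow> R ^ Suc j * 0 ^ j"
          by (intro tendsto_intros lim_1_over_n)
        then have lim0: "(\<lambda>n. R ^ Suc j * (1 / real n) ^ j) \<longlonglongrightarrow> 0"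
          using Suc by simp
        have "norm (H n $ j / of_nat n ^ Suc j) \<le> R ^ Suc j * (1 / real n) ^ j" for n
        proof (cases "n = 0")
          case True
          then show ?thesis using \<open>R > 0\<close> by simp
        next
          case False
          then show ?thesis
            using H_le'[of n j] by (simp add: norm_divide norm_mult norm_power field_simps)
        qed
        then have "(\<lambda>n. H n $ j / of_nat n ^ Suc j) \<longlonglongrightarrow> 0"
          by (intro Lim_null_comparison[OF always_eventually lim0] allI)
        then show ?thesis
          by (simp add: Suc)
      qed
    qed
    then have "(\<lambda>n. \<Sum>j\<le>m. H n $ j / of_nat n ^ Suc j * (?q (m - j) n * c (m - j))) \<longlonglongrightarrow>
        (\<Sum>j\<le>m. (if j = 0 then c 1 / c 0 else 0) * (1 / fact (m - j) * c (m - j)))"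
      by (intro tendsto_sum)
    moreover have "(\<Sum>j\<le>m. (if j = 0 then c 1 / c 0 else 0) * (1 / fact (m - j) * c (m - j))) =
        c 1 / c 0 * (1 / fact m * c m)"
      by (subst sum.remove[of _ 0]) auto
    moreover have "(\<Sum>j\<le>m. H n $ j / of_nat n ^ Suc j * (?q (m - j) n * c (m - j))) =
        of_nat (Suc m) * (?q (Suc m) n * c (Suc m))" for n
    proof -
      have "of_nat (Suc m) * (?q (Suc m) n * c (Suc m)) =
          of_nat (Suc m) * (of_nat (n choose Suc m) * c (Suc m)) / of_nat n ^ Suc m"
        by simp
      also have "\<dots> = (\<Sum>j\<le>m. H n $ j * (of_nat (n choose (m - j)) * c (m - j)) / of_nat n ^ Suc m)"
        unfolding rec sum_divide_distrib ..
      also have "\<dots> = (\<Sum>j\<le>m. H n $ j / of_nat n ^ Suc j * (?q (m - j) n * c (m - j)))"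
      proof (rule sum.cong)
        fix j assume "j \<in> {..m}"
        then have "Suc m = Suc j + (m - j)" by simp
        then have "of_nat n ^ Suc m = (of_nat n ^ Suc j * of_nat n ^ (m - j) :: complex)"
          by (metis power_add)
        then show "H n $ j * (of_nat (n choose (m - j)) * c (m - j)) / of_nat n ^ Suc m =
            H n $ j / of_nat n ^ Suc j * (?q (m - j) n * c (m - j))"
          by simp
      qed simp
      finally show ?thesis ..
    qed
    ultimately have "(\<lambda>n. of_nat (Suc m) * (?q (Suc m) n * c (Suc m))) \<longlonglongrightarrow> c 1 / c 0 * (1 / fact m * c m)"
      by simp
    moreover have "(\<lambda>n. of_nat (Suc m) * (?q (Suc m) n * c (Suc m))) \<longlonglongrightarrow>
        of_nat (Suc m) * (1 / fact (Suc m) * c (Suc m))"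
      by (intro tendsto_mult LIMSEQ_binomial_over_power tendsto_const)
    ultimately have "c 1 / c 0 * (1 / fact m * c m) = of_nat (Suc m) * (1 / fact (Suc m) * c (Suc m))"
      by (rule LIMSEQ_unique)
    then show ?thesis
      by (simp add: field_simps del: of_nat_Suc)
  qed
  have c_eq: "c k = c 0 * (c 1 / c 0) ^ k" for k
  proof (induction k)
    case (Suc k)
    then show ?case
      using c_Suc[of k] by (simp del: One_nat_def)
  qed simp
  have "L f = (\<Sum>i\<le>degree f. coeff f i * (c 0 * (c 1 / c 0) ^ i))"
    unfolding L_eq[OF order_refl] by (intro sum.cong refl arg_cong2[where f="(*)"] c_eq)
  then have "L f = c 0 * poly f (c 1 / c 0)"
    by (simp add: poly_altdef sum_distrib_left mult_ac)
  then show ?thesis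
    by (simp add: c_def monom_Suc one_pCons)
qed

section \<open>Divisibility read off from powers\<close>

lemma dvd_if_power_dvd_power_Suc:
  fixes p q :: "complex poly"
  assumes "p \<noteq> 0" and dvd: "\<And>k. p ^ k dvd q ^ Suc k"
  shows "p dvd q"
proof (cases "q = 0")
  case False
  show ?thesis
  proof (rule multiplicity_le_imp_dvd[OF \<open>p \<noteq> 0\<close>])
    fix r :: "complex poly" assume r: "prime r"
    have le: "k * multiplicity r p \<le> Suc k * multiplicity r q" for k
      using dvd_imp_multiplicity_le[OF dvd[of k], of r] False \<open>p \<noteq> 0\<close> r
      by (simp add: prime_elem_multiplicity_power_distrib del: power_Suc)
    show "multiplicity r p \<le> multiplicity r q"
    proof (rule ccontr)
      \<comment> \<open>With m the multiplicity of r in q, the exponent k = m + 1 is large enough: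
        if r had multiplicity at least m + 1 in p, then (m + 1)^2 would be at most (m + 2) * m = (m
        + 1)^2 - 1.\<close>
      let ?k = "Suc (multiplicity r q)"
      assume "\<not> multiplicity r p \<le> multiplicity r q"
      then have "?k * ?k \<le> ?k * multiplicity r p"
        by (intro mult_le_mono) auto
      then show False
        using le[of ?k] by simp
    qed
  qed
qed simp

section \<open>Operators that kill a polynomial zero-free on a compact set\<close>

lemma linear_functionalI:
  fixes L :: "complex poly \<Rightarrow> complex"
  assumes "\<And>f g. L (f + g) = L f + L g" and "\<And>c f. L (smult c f) = c * L f"
  shows "Vector_Spaces.linear smult (*) L"
proof -
  have "vector_space ((*) :: complex \<Rightarrow> complex \<Rightarrow> complex)"
    by unfold_locales (simp_all add: algebra_simps)
  then show ?thesis
    using assms vector_space_smult by (simp add: Vector_Spaces.linear_iff)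
qed

text \<open>An element of \<open>zero_free_polys \<Omega>\<close> that vanishes at \<open>w\<close>
  is 0, so evaluation at \<open>w\<close> is injective on the range of \<open>A\<close>.\<close>

lemma rank_le_one_if_range_subset_zero_free:
  fixes A :: "complex poly \<Rightarrow> complex poly"
  assumes A: "Vector_Spaces.linear smult smult A" and "w \<in> \<Omega>"
    and range: "range A \<subseteq> zero_free_polys \<Omega>"
  shows "\<exists>\<nu> :: complex poly \<Rightarrow> complex. \<exists>\<psi> \<in> zero_free_polys \<Omega>.
    Vector_Spaces.linear smult (*) \<nu> \<and> (\<forall>f. A f = smult (\<nu> f) \<psi>)"
proof -
  interpret Vector_Spaces.linear smult smult A by fact
  \<comment> \<open>If \<open>A\<close> is not the zero map, this picks some g with A g nonzero;
    otherwise any g will do, and then \<nu> is identically 0 by division by zero.\<close>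
  obtain g where g: "A g = 0 \<Longrightarrow> \<forall>f. A f = 0"
    by blast
  define \<nu> where "\<nu> f = poly (A f) w / poly (A g) w" for f
  have "Vector_Spaces.linear smult (*) \<nu>"
    by (rule linear_functionalI) (simp_all add: \<nu>_def add scale add_divide_distrib)
  moreover have "A f = smult (\<nu> f) (A g)" for f
  proof (cases "A g = 0")
    case True
    then show ?thesis using g by simp
  next
    case False
    then have "poly (A g) w \<noteq> 0"
      using range \<open>w \<in> \<Omega>\<close> by (force simp: zero_free_polys_def)
    then have "poly (A (f - smult (\<nu> f) g)) w = 0"
      by (simp add: diff scale \<nu>_def)
    then have "A (f - smult (\<nu> f) g) = 0"
      using range \<open>w \<in> \<Omega>\<close> by (force simp: zero_free_polys_def)
    then show ?thesis
      by (simp add: diff scale)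
  qed
  moreover have "A g \<in> zero_free_polys \<Omega>"
    using range by auto
  ultimately show ?thesis
    by blast
qed

text \<open>Adding a multiple of \<open>f\<close> to g does not change A g. If B bounds g/f on
  \<open>K\<close>, then (B + 1) f + g has no zero there, since at a zero g/f would equal -(B +
  1).\<close>

lemma range_subset_zero_free_if_kernel:
  fixes A :: "complex poly \<Rightarrow> complex poly"
  assumes A: "Vector_Spaces.linear smult smult A"
    and sub: "A ` zero_free_polys \<Omega>1 \<subseteq> zero_free_polys \<Omega>2"
    and "compact K" "\<Omega>1 \<subseteq> K" and f: "\<And>z. z \<in> K \<Longrightarrow> poly f z \<noteq> 0" and "A f = 0"
  shows "range A \<subseteq> zero_free_polys \<Omega>2"
proof clarify
  fix g
  interpret Vector_Spaces.linear smult smult A by fact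
  have "compact ((\<lambda>z. poly g z / poly f z) ` K)"
    using f by (intro compact_continuous_image continuous_intros \<open>compact K\<close>) auto
  then obtain B where B: "B > 0" "\<And>z. z \<in> K \<Longrightarrow> norm (poly g z / poly f z) \<le> B"
    by (force dest: compact_imp_bounded simp: bounded_pos)
  define h where "h = smult (of_real (B + 1)) f + g"
  have "poly h z \<noteq> 0" if "z \<in> K" for z
  proof
    assume "poly h z = 0"
    then have "poly g z / poly f z = - of_real (B + 1)"
      using f[OF that] by (simp add: h_def field_simps add_eq_0_iff)
    then have "norm (poly g z / poly f z) = B + 1"
      using \<open>B > 0\<close> by (metis abs_of_pos add_pos_pos norm_minus_cancel norm_of_real zero_less_one)
    then show False
      using B(2)[OF that] by simp
  qed
  then have "h \<in> zero_free_polys \<Omega>1"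
    using \<open>\<Omega>1 \<subseteq> K\<close> by (auto simp: zero_free_polys_def)
  moreover have "A h = A g"
    by (simp add: h_def add scale \<open>A f = 0\<close>)
  ultimately show "A g \<in> zero_free_polys \<Omega>2"
    using sub by force
qed

section \<open>Operators that are weighted compositions\<close>

lemma poly_eqI_infinite:
  fixes p q :: "complex poly"
  assumes "infinite S" and "\<And>z. z \<in> S \<Longrightarrow> poly p z = poly q z"
  shows "p = q"
proof (rule ccontr)
  assume "p \<noteq> q"
  then have "finite {z. poly (p - q) z = 0}"
    by (intro poly_roots_finite) simp
  moreover have "S \<subseteq> {z. poly (p - q) z = 0}"
    using assms(2) by auto
  ultimately show False
    using \<open>infinite S\<close> finite_subset by blast
qed

text \<open>Pointwise on \<Omega>, \<open>A\<close> is a weighted composition with the rational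
  function A z / A 1. What remains is that A 1 divides A z, which follows from the images of the
  powers of z being polynomials.\<close>

lemma eq_weighted_comp_if_kernel_trivial:
  fixes A :: "complex poly \<Rightarrow> complex poly"
  assumes A: "Vector_Spaces.linear smult smult A" and "infinite \<Omega>" and "R > 0"
    and nz: "\<And>f w. (\<And>z. norm z \<le> R \<Longrightarrow> poly f z \<noteq> 0) \<Longrightarrow> w \<in> \<Omega> \<Longrightarrow> poly (A f) w \<noteq> 0"
  shows "\<exists>\<phi>. A = weighted_comp (A 1) \<phi>"
proof -
  interpret Vector_Spaces.linear smult smult A by fact
  let ?X = "[:0, 1:] :: complex poly"
  have A1: "poly (A 1) w \<noteq> 0" if "w \<in> \<Omega>" for w
    using nz[of 1 w] that by simp
  have A_eq: "poly (A f) w = poly (A 1) w * poly f (poly (A ?X) w / poly (A 1) w)" if "w \<in> \<Omega>" for f w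
  proof (rule linear_functional_eq_scaled_eval[OF _ \<open>R > 0\<close>])
    show "Vector_Spaces.linear smult (*) (\<lambda>f. poly (A f) w)"
      by (rule linear_functionalI) (simp_all add: add scale)
    show "poly (A f) w \<noteq> 0" if "\<And>z. norm z \<le> R \<Longrightarrow> poly f z \<noteq> 0" for f
      using nz that \<open>w \<in> \<Omega>\<close> by blast
  qed
  \<comment> \<open>At w in \<Omega>, A (z^(k+1)) has the value A 1 * (A z / A 1)^(k+1); multiplying
    by (A 1)^k clears the denominator.\<close>
  have "A 1 ^ k * A (?X ^ Suc k) = A ?X ^ Suc k" for k
  proof (rule poly_eqI_infinite[OF \<open>infinite \<Omega>\<close>])
    fix w assume "w \<in> \<Omega>"
    then show "poly (A 1 ^ k * A (?X ^ Suc k)) w = poly (A ?X ^ Suc k) w"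
      using A1[of w] by (simp add: A_eq[of w "?X ^ Suc k"] power_divide del: power_Suc) simp
  qed
  then have "A 1 ^ k dvd A ?X ^ Suc k" for k
    by (metis dvd_triv_left)
  moreover have "A 1 \<noteq> 0"
    using A1 \<open>infinite \<Omega>\<close> by (metis finite.emptyI ex_in_conv poly_0)
  ultimately have "A 1 dvd A ?X"
    by (rule dvd_if_power_dvd_power_Suc[rotated])
  then obtain \<phi> where \<phi>: "A ?X = A 1 * \<phi>" ..
  have "A f = weighted_comp (A 1) \<phi> f" for f
  proof (rule poly_eqI_infinite[OF \<open>infinite \<Omega>\<close>])
    fix w assume "w \<in> \<Omega>"
    then show "poly (A f) w = poly (weighted_comp (A 1) \<phi> f) w"
      using A1[of w] by (simp add: A_eq[of w f] \<phi> weighted_comp_def poly_pcompose)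
  qed
  then show ?thesis
    by blast
qed

section \<open>The two implications of the characterisation\<close>

theorem theorem2:
  fixes \<Omega>1 \<Omega>2 :: "complex set"
    and A :: "complex poly \<Rightarrow> complex poly"
  assumes "bounded \<Omega>1"
    and "interior \<Omega>2 \<noteq> {}"
    and "Vector_Spaces.linear smult smult A"
  shows "A ` zero_free_polys \<Omega>1 \<subseteq> zero_free_polys \<Omega>2 \<longleftrightarrow>
    (\<exists>\<nu> :: complex poly \<Rightarrow> complex. \<exists>\<psi> \<in> zero_free_polys \<Omega>2.
        Vector_Spaces.linear smult (*) \<nu> \<and> (\<forall>f. A f = smult (\<nu> f) \<psi>)) \<or>
    (\<exists>\<psi> \<in> zero_free_polys \<Omega>2. \<exists>\<phi> :: complex poly.
        degree \<phi> > 0 \<and> poly \<phi> ` \<Omega>2 \<subseteq> \<Omega>1 \<and> A = weighted_comp \<psi> \<phi>)"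
    (is "?preserves \<longleftrightarrow> ?rank_one \<or> ?comp")
proof
  assume "?rank_one \<or> ?comp"
  then show ?preserves
    by (auto simp: zero_free_polys_def weighted_comp_def poly_pcompose image_subset_iff)
next
  assume sub: ?preserves
  have "infinite \<Omega>2"
    using assms(2) by (metis empty_interior_finite)
  then obtain w0 where "w0 \<in> \<Omega>2"
    by (metis finite.emptyI ex_in_conv)
  obtain R where "R > 0" and R: "\<Omega>1 \<subseteq> cball 0 R"
    using bounded_subset_ballD[OF assms(1), of 0] ball_subset_cball by (metis order_trans)
  show "?rank_one \<or> ?comp"
  \<comment> \<open>Zeros are excluded on the closed disc rather than on \<Omega>1 because
    compactness is what bounds the quotient g/f.\<close>
  proof (cases "\<exists>f. (\<forall>z\<in>cball 0 R. poly f z \<noteq> 0) \<and> A f = 0")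
    case True
    then have "range A \<subseteq> zero_free_polys \<Omega>2"
      using range_subset_zero_free_if_kernel[OF assms(3) sub compact_cball R] by blast
    then show ?thesis
      using rank_le_one_if_range_subset_zero_free[OF assms(3) \<open>w0 \<in> \<Omega>2\<close>] by blast
  next
    case False
    have nz: "poly (A f) w \<noteq> 0" if f: "\<And>z. norm z \<le> R \<Longrightarrow> poly f z \<noteq> 0" and "w \<in> \<Omega>2" for f w
    proof -
      have "f \<in> zero_free_polys \<Omega>1"
        using f R by (force simp: zero_free_polys_def)
      then have "A f \<in> zero_free_polys \<Omega>2"
        using sub by blast
      moreover have "A f \<noteq> 0"
        using False f by (metis mem_cball_0)
      ultimately show ?thesis
        using \<open>w \<in> \<Omega>2\<close> by (auto simp: zero_free_polys_def)
    qed
    then obtain \<phi> where \<phi>: "A = weighted_comp (A 1) \<phi>"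
      using eq_weighted_comp_if_kernel_trivial[OF assms(3) \<open>infinite \<Omega>2\<close> \<open>R > 0\<close>] by blast
    have A1: "A 1 \<in> zero_free_polys \<Omega>2" "A 1 \<noteq> 0"
      using nz[of 1] \<open>w0 \<in> \<Omega>2\<close> by (auto simp: zero_free_polys_def)
    show ?thesis
    \<comment> \<open>A constant \<phi> turns composition into evaluation at a point, which gives
      the rank-one alternative wherever that point lies.\<close>
    proof (cases "degree \<phi> = 0")
      case True
      then obtain a where "\<phi> = [:a:]"
        by (metis degree_eq_zeroE)
      moreover have "f \<circ>\<^sub>p [:a:] = [:poly f a:]" for f :: "complex poly"
        by (induction f) (simp_all add: pcompose_pCons)
      ultimately have "A f = smult (poly f a) (A 1)" for f
        by (subst \<phi>) (simp add: weighted_comp_def)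
      moreover have "Vector_Spaces.linear smult (*) (\<lambda>f. poly f a)"
        by (rule linear_functionalI) simp_all
      ultimately show ?thesis
        using A1(1) by blast
    next
      case False
      have "poly \<phi> w \<in> \<Omega>1" if "w \<in> \<Omega>2" for w
      proof (rule ccontr)
        assume "poly \<phi> w \<notin> \<Omega>1"
        \<comment> \<open>The test polynomial z - \<phi>(w) has its only zero outside \<Omega>1, but
          its image A 1 * (\<phi> - \<phi>(w)) vanishes at w. The image must then be 0, which forces
          \<phi> to be constant.\<close>
        then have "[:- poly \<phi> w, 1:] \<in> zero_free_polys \<Omega>1"
          by (auto simp: zero_free_polys_def)
        then have "A [:- poly \<phi> w, 1:] \<in> zero_free_polys \<Omega>2"
          using sub by blast
        moreover have A_eq: "A [:- poly \<phi> w, 1:] = A 1 * (\<phi> - [:poly \<phi> w:])"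
          by (subst \<phi>) (simp add: weighted_comp_def pcompose_pCons algebra_simps)
        moreover have "poly (A [:- poly \<phi> w, 1:]) w = 0"
          by (simp add: A_eq)
        ultimately have "A 1 * (\<phi> - [:poly \<phi> w:]) = 0"
          using that by (auto simp: zero_free_polys_def)
        then have "\<phi> = [:poly \<phi> w:]"
          using A1(2) by simp
        then show False
          using False by (metis degree_pCons_0)
      qed
      then show ?thesis
        using \<phi> A1(1) False by blast
    qed
  qed
qed

end
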